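(* The lines $\mathbb R\times\{\lambda_1\}$ and $\{\lambda_1\}\times\mathbb R$ are isolated in $\Sigma_K$; in other words, there exists no sequence $(\alpha_k,\beta_k)\in\Sigma_K$ with $\alpha_k>\lambda_1$ and $\beta_k>\lambda_1$ such that $(\alpha_k,\beta_k)\to(\alpha,\beta)$ with $\alpha=\lambda_1$ or $\beta=\lambda_1$.
   Context: Let $s\in(0,1)$, $n>2s$, and let $\Omega\subset\mathbb R^n$ be a bounded domain with Lipschitz boundary. Let $K:\mathbb R^n\setminus\{0\}\to(0,\infty)$ satisfy: (i) $mK\in L^1(\mathbb R^n)$ with $m(x)=\min\{|x|^2,1\}$; (ii) there is $\lambda>0$ with $K(x)\ge\lambda|x|^{-(n+2s)}$ for all $x\ne0$; (iii) $K(x)=K(-x)$. Put $Q=\mathbb R^{2n}\setminus((\mathbb R^n\setminus\Omega)\times(\mathbb R^n\setminus\Omega))$. Let $X$ be the space of measurable $u:\mathbb R^n\to\mathbb R$ with $u|_\Omega\in L^2(\Omega)$ and $(u(x)-u(y))\sqrt{K(x-y)}\in L^2(Q)$, and let $X_0=\{u\in X: u=0 \text{ a.e. in }\mathbb R^n\setminus\Omega\}$, a Hilbert space with norm $\|u\|_{X_0}=\left(\int_Q|u(x)-u(y)|^2K(x-y)\,dx\,dy\right)^{1/2}$. Write $u^\pm=\max(\pm u,0)$. The Fučík spectrum $\Sigma_K$ is the set of $(\alpha,\beta)\in\mathbb R^2$ for which the problem $-\mathcal L_Ku=\alpha u^+-\beta u^-$ in $\Omega$, $u=0$ in $\mathbb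 R^n\setminus\Omega$, has a nontrivial weak solution, where $\mathcal L_Ku(x)=\frac12\int_{\mathbb R^n}(u(x+y)+u(x-y)-2u(x))K(y)\,dy$. Here $u\in X_0$ is a weak solution if for all $v\in X_0$: $\int_Q(u(x)-u(y))(v(x)-v(y))K(x-y)\,dx\,dy=\alpha\int_\Omega u^+v\,dx-\beta\int_\Omega u^-v\,dx$. $\lambda_1=\inf\{\|u\|_{X_0}^2: u\in X_0,\ \int_\Omega u^2=1\}$ is the first eigenvalue of $-\mathcal L_K$; it is simple and its eigenfunctions have constant sign. *)

theory Defs
  imports "HOL-Analysis.Analysis"
begin

(* Locally, after a rigid motion, the domain is the strict epigraph of a Lipschitz function.
   The unit vector e is the vertical direction, x - (x \<bullet> e) e is the projection of x onto the
   hyperplane orthogonal to e, and only the values of g on that hyperplane matter. *)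
definition lipschitz_boundary :: "'a::euclidean_space set \<Rightarrow> bool" where
  "lipschitz_boundary \<Omega> \<longleftrightarrow>
     (\<forall>x0\<in>frontier \<Omega>. \<exists>r>0. \<exists>e g C. norm e = 1 \<and> C-lipschitz_on {y. y \<bullet> e = 0} g \<and>
        \<Omega> \<inter> ball x0 r = {x \<in> ball x0 r. g (x - (x \<bullet> e) *\<^sub>R e) < x \<bullet> e})"

definition bounded_lipschitz_domain :: "'a::euclidean_space set \<Rightarrow> bool" where
  "bounded_lipschitz_domain \<Omega> \<longleftrightarrow>
     open \<Omega> \<and> connected \<Omega> \<and> \<Omega> \<noteq> {} \<and> bounded \<Omega> \<and> lipschitz_boundary \<Omega>"

definition L2_on :: "'a::euclidean_space set \<Rightarrow> ('a \<Rightarrow> real) \<Rightarrow> bool" where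
  "L2_on A f \<longleftrightarrow>
     set_borel_measurable lebesgue A f \<and> set_integrable lebesgue A (\<lambda>x. (f x)\<^sup>2)"

(* K is a function on the space without the origin. Its junk value K 0 only enters on the
   diagonal of the product space, which is a null set. *)
definition fractional_kernel :: "real \<Rightarrow> ('a::euclidean_space \<Rightarrow> real) \<Rightarrow> bool" where
  "fractional_kernel s K \<longleftrightarrow>
     (\<forall>x. x \<noteq> 0 \<longrightarrow> K x > 0) \<and>
     integrable lebesgue (\<lambda>x. min ((norm x)\<^sup>2) 1 * K x) \<and>
     (\<exists>c>0. \<forall>x. x \<noteq> 0 \<longrightarrow> K x \<ge> c * norm x powr (- (real DIM('a) + 2 * s))) \<and>
     (\<forall>x. x \<noteq> 0 \<longrightarrow> K (- x) = K x)"

definition Q_set :: "'a set \<Rightarrow> ('a \<times> 'a) set" where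
  "Q_set \<Omega> = - ((- \<Omega>) \<times> (- \<Omega>))"

definition X_space :: "('a::euclidean_space \<Rightarrow> real) \<Rightarrow> 'a set \<Rightarrow> ('a \<Rightarrow> real) set" where
  "X_space K \<Omega> = {u. u \<in> borel_measurable lebesgue \<and> L2_on \<Omega> u \<and>
     L2_on (Q_set \<Omega>) (\<lambda>(x, y). (u x - u y) * sqrt (K (x - y)))}"

(* Elements are functions, not classes modulo equality almost everywhere. *)
definition X0_space :: "('a::euclidean_space \<Rightarrow> real) \<Rightarrow> 'a set \<Rightarrow> ('a \<Rightarrow> real) set" where
  "X0_space K \<Omega> = {u \<in> X_space K \<Omega>. AE x in lebesgue. x \<notin> \<Omega> \<longrightarrow> u x = 0}"

definition X0_norm :: "('a::euclidean_space \<Rightarrow> real) \<Rightarrow> 'a set \<Rightarrow> ('a \<Rightarrow> real) \<Rightarrow> real" where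
  "X0_norm K \<Omega> u =
     sqrt (LINT z:Q_set \<Omega>|lebesgue. \<bar>u (fst z) - u (snd z)\<bar>\<^sup>2 * K (fst z - snd z))"

definition fucik_weak_solution ::
    "('a::euclidean_space \<Rightarrow> real) \<Rightarrow> 'a set \<Rightarrow> real \<Rightarrow> real \<Rightarrow> ('a \<Rightarrow> real) \<Rightarrow> bool" where
  "fucik_weak_solution K \<Omega> \<alpha> \<beta> u \<longleftrightarrow> u \<in> X0_space K \<Omega> \<and>
     (\<forall>v\<in>X0_space K \<Omega>.
        (LINT z:Q_set \<Omega>|lebesgue.
           (u (fst z) - u (snd z)) * (v (fst z) - v (snd z)) * K (fst z - snd z))
        = \<alpha> * (LINT x:\<Omega>|lebesgue. max (u x) 0 * v x)
          - \<beta> * (LINT x:\<Omega>|lebesgue. max (- u x) 0 * v x))"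

definition fucik_spectrum :: "('a::euclidean_space \<Rightarrow> real) \<Rightarrow> 'a set \<Rightarrow> (real \<times> real) set" where
  "fucik_spectrum K \<Omega> =
     {(\<alpha>, \<beta>). \<exists>u. fucik_weak_solution K \<Omega> \<alpha> \<beta> u \<and> \<not> (AE x in lebesgue. u x = 0)}"

definition lambda1 :: "('a::euclidean_space \<Rightarrow> real) \<Rightarrow> 'a set \<Rightarrow> real" where
  "lambda1 K \<Omega> =
     Inf {(X0_norm K \<Omega> u)\<^sup>2 | u. u \<in> X0_space K \<Omega> \<and> (LINT x:\<Omega>|lebesgue. (u x)\<^sup>2) = 1}"

end

theory Submission
  imports Defs
begin

text \<open>
  Write \<open>B(u, v)\<close> for the bilinear form of the problem, and let \<open>u\<close> solve it for a pair
  \<open>(\<alpha>, \<beta>)\<close> with \<open>\<alpha>, \<beta> > \<lambda>\<^sub>1\<close>. The theorem follows from a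
  quantitative gap: as long as \<open>\<alpha>, \<beta> \<le> M\<close>, the product
  \<open>(\<alpha> - \<lambda>\<^sub>1) (\<beta> - \<lambda>\<^sub>1)\<close> is bounded below by a positive constant
  that depends neither on \<open>u\<close> nor on the pair (\<open>fucik_gap\<close>). Along a sequence that converges to a point of one of the two
  lines this product would tend to \<open>0\<close>.

  Since the operator is nonlocal, the positive and the negative part of \<open>u\<close> interact: \<open>K\<close> is at
  least some \<open>\<kappa> > 0\<close> on differences of distinct points of the bounded set \<open>\<Omega>\<close>, so
  \<open>- B(u\<^sup>+, u\<^sup>-) \<ge> 2 \<kappa> \<integral>u\<^sup>+ \<integral>u\<^sup>-\<close>.
  Testing the equation with \<open>u\<^sup>+\<close> gives
  \<open>B(u\<^sup>+, u\<^sup>+) - B(u\<^sup>+, u\<^sup>-) = \<alpha> \<integral>(u\<^sup>+)\<^sup>2\<close>,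
  whence \<open>2 \<kappa> \<integral>u\<^sup>+ \<integral>u\<^sup>- \<le> (\<alpha> - \<lambda>\<^sub>1) \<integral>(u\<^sup>+)\<^sup>2\<close>
  by the variational characterisation of \<open>\<lambda>\<^sub>1\<close>; symmetrically with \<open>u\<^sup>-\<close> and
  \<open>\<beta>\<close>. The two bounds are multiplied. What is left is to compare the \<open>L\<^sup>1\<close> norms with the
  \<open>L\<^sup>2\<close> norms from below, and that is a Nash inequality (\<open>nash_inequality\<close>): functions whose
  energy is controlled by their \<open>L\<^sup>2\<close> norm cannot have a small \<open>L\<^sup>1\<close> norm.

  The argument needs both parts of \<open>u\<close> to be nonzero (\<open>neg_part_nontrivial\<close>). A nonnegative
  eigenfunction \<open>u\<close> with an eigenvalue above \<open>\<lambda>\<^sub>1\<close> would be almost orthogonal to a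
  normalised nonnegative near-minimiser \<open>p\<close> of the energy, so that \<open>p - t u\<close> would have
  positive part close to \<open>p\<close> and negative part close to \<open>t u\<close>. By the interaction of these
  parts, passing to \<open>\<bar>p - t u\<bar>\<close> lowers the energy by an amount linear in \<open>t\<close>, while the
  energy excess of \<open>p - t u\<close> over \<open>\<lambda>\<^sub>1\<close> is, up to an
  arbitrarily small error, at most quadratic in \<open>t\<close> (\<open>no_nonneg_eigenfunction_above\<close>).
\<close>

section \<open>Fubini arguments for the completed Lebesgue measure\<close>

lemma null_set_cylinders:
  fixes N :: "'a::euclidean_space set"
  assumes "N \<in> null_sets lborel"
  shows "fst -` N \<in> null_sets (lborel :: ('a \<times> 'b::euclidean_space) measure)"
    and "snd -` N \<in> null_sets (lborel :: ('b \<times> 'a) measure)"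
proof -
  have [simp]: "fst -` N = N \<times> (UNIV :: 'b set)" "snd -` N = (UNIV :: 'b set) \<times> N"
    by auto
  have N: "N \<in> sets borel" "emeasure lborel N = 0"
    using assms by (auto simp: null_sets_def)
  have "emeasure (lborel \<Otimes>\<^sub>M lborel) (N \<times> (UNIV :: 'b set)) = 0"
    by (subst lborel.emeasure_pair_measure_Times) (use N in auto)
  moreover have "emeasure (lborel \<Otimes>\<^sub>M lborel) ((UNIV :: 'b set) \<times> N) = 0"
    by (subst lborel.emeasure_pair_measure_Times) (use N in auto)
  moreover have "N \<times> (UNIV :: 'b set) \<in> sets borel" "(UNIV :: 'b set) \<times> N \<in> sets borel"
    using N by (auto simp: borel_prod[symmetric])
  ultimately show "fst -` N \<in> null_sets (lborel :: ('a \<times> 'b) measure)"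
    "snd -` N \<in> null_sets (lborel :: ('b \<times> 'a) measure)"
    by (auto simp: lborel_prod null_sets_def)
qed

text \<open>
  Preimages of Lebesgue sets need this extra argument because a Lebesgue set differs from a Borel set
  by a subset of a null set, which is pulled back to a subset of a null cylinder.
\<close>
lemma measurable_lebesgue_projections:
  "fst \<in> (lebesgue :: ('a::euclidean_space \<times> 'b::euclidean_space) measure) \<rightarrow>\<^sub>M lebesgue"
  "snd \<in> (lebesgue :: ('b \<times> 'a) measure) \<rightarrow>\<^sub>M lebesgue"
proof -
  let ?M = "lebesgue :: ('a \<times> 'b) measure" and ?M' = "lebesgue :: ('b \<times> 'a) measure"
  have fst: "fst \<in> ?M \<rightarrow>\<^sub>M lborel" and snd: "snd \<in> ?M' \<rightarrow>\<^sub>M lborel"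
    by (auto intro!: measurable_completion borel_measurable_continuous_onI continuous_intros)
  have "N \<in> null_sets (distr ?M lborel fst)" if "N \<in> null_sets lborel" for N
    unfolding null_sets_distr_iff[OF fst]
    using that null_set_cylinders(1)[OF that, THEN null_sets_completionI] by auto
  then show "fst \<in> ?M \<rightarrow>\<^sub>M lebesgue"
    by (intro completion.measurable_completion2[OF fst]) auto
  have "N \<in> null_sets (distr ?M' lborel snd)" if "N \<in> null_sets lborel" for N
    unfolding null_sets_distr_iff[OF snd]
    using that null_set_cylinders(2)[OF that, THEN null_sets_completionI] by auto
  then show "snd \<in> ?M' \<rightarrow>\<^sub>M lebesgue"
    by (intro completion.measurable_completion2[OF snd]) auto
qed

lemma AE_lebesgue_cylinders:
  assumes "AE x in lebesgue. P (x::'a::euclidean_space)"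
  shows "AE z in (lebesgue :: ('a \<times> 'b::euclidean_space) measure). P (fst z)"
    and "AE z in (lebesgue :: ('b \<times> 'a) measure). P (snd z)"
proof -
  from assms have "AE x in lborel. P x"
    by (simp add: AE_completion_iff)
  then obtain N where N: "N \<in> null_sets lborel" "{x. \<not> P x} \<subseteq> N"
    by (auto simp: eventually_ae_filter)
  show "AE z in (lebesgue :: ('a \<times> 'b) measure). P (fst z)"
    by (rule AE_completion, rule AE_I'[OF null_set_cylinders(1)[OF N(1)]]) (use N in auto)
  show "AE z in (lebesgue :: ('b \<times> 'a) measure). P (snd z)"
    by (rule AE_completion, rule AE_I'[OF null_set_cylinders(2)[OF N(1)]]) (use N in auto)
qed

lemma lebesgue_integrable_borel_version:
  fixes f :: "'a::euclidean_space \<Rightarrow> real"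
  assumes "integrable lebesgue f"
  obtains f' where "f' \<in> borel_measurable borel" "integrable lborel f'"
    "AE x in lebesgue. f x = f' x" "integral\<^sup>L lborel f' = integral\<^sup>L lebesgue f"
proof -
  from assms have f: "f \<in> borel_measurable lebesgue" by auto
  then obtain f' where f': "f' \<in> borel_measurable lborel" "AE x in lborel. f x = f' x"
    using completion_ex_borel_measurable_real by blast
  then have ae: "AE x in lebesgue. f x = f' x" by (simp add: AE_completion)
  have f'l: "f' \<in> borel_measurable lebesgue" using f'(1) by (rule measurable_completion)
  have "integrable lebesgue f'"
    using assms integrable_cong_AE[OF f f'l ae] by simp
  moreover have "integral\<^sup>L lebesgue f = integral\<^sup>L lebesgue f'"
    using integral_cong_AE[OF f f'l ae] .
  ultimately show thesis
    using that f' ae by (simp add: integrable_completion integral_completion)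
qed

text \<open>
  Both instances of Fubini's theorem that are needed below, a product and the indicator of a tube
  around the diagonal, have a second factor whose integral over the second variable is constant.
  The completed measure is not a product measure, so \<open>f\<close> is first replaced by a Borel function
  that agrees with it off a null set; the exceptional set in the product is a null cylinder.
\<close>
lemma lebesgue_fubini_constant_marginal:
  fixes f :: "'a::euclidean_space \<Rightarrow> real" and k :: "'a \<times> 'b::euclidean_space \<Rightarrow> real"
  assumes f: "integrable lebesgue f" and k: "k \<in> borel_measurable borel"
    and ki: "\<And>x. integrable lborel (\<lambda>y. k (x, y))"
    and c: "\<And>x. (LINT y|lborel. k (x, y)) = c"
    and c': "\<And>x. (LINT y|lborel. \<bar>k (x, y)\<bar>) = c'"
  shows "integrable lebesgue (\<lambda>z. f (fst z) * k z)"
    and "(LINT z|lebesgue. f (fst z) * k z) = c * integral\<^sup>L lebesgue f"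
proof -
  obtain f' where f': "f' \<in> borel_measurable borel" "integrable lborel f'"
    "AE x in lebesgue. f x = f' x" "integral\<^sup>L lborel f' = integral\<^sup>L lebesgue f"
    using lebesgue_integrable_borel_version[OF f] .
  let ?h = "\<lambda>z. f' (fst z) * k z"
  have k2: "k \<in> borel_measurable (lborel \<Otimes>\<^sub>M lborel)"
    using k by (simp add: lborel_prod)
  have h: "?h \<in> borel_measurable (lborel \<Otimes>\<^sub>M lborel)"
    using k2 f'(1) by measurable
  have inth: "integrable (lborel \<Otimes>\<^sub>M lborel) ?h"
  proof (rule lborel_pair.Fubini_integrable[OF h])
    show "integrable lborel (\<lambda>x. LINT y|lborel. norm (f' (fst (x, y)) * k (x, y)))"
      using f'(2) by (simp add: abs_mult c')
    show "AE x in lborel. integrable lborel (\<lambda>y. f' (fst (x, y)) * k (x, y))"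
      using ki by simp
  qed
  have "integral\<^sup>L (lborel \<Otimes>\<^sub>M lborel) ?h = (LINT x|lborel. (LINT y|lborel. ?h (x, y)))"
    by (rule lborel_pair.integral_fst'[OF inth, symmetric])
  also have "\<dots> = c * integral\<^sup>L lborel f'"
    using c by simp
  finally have eq: "integral\<^sup>L lborel ?h = c * integral\<^sup>L lborel f'"
    by (simp add: lborel_prod)
  have hl: "integrable lborel ?h" using inth by (simp add: lborel_prod)
  then have hb: "?h \<in> borel_measurable lborel" by auto
  have h1: "integrable lebesgue ?h" "integral\<^sup>L lebesgue ?h = c * integral\<^sup>L lebesgue f"
    using hl eq f'(4) by (simp_all add: integrable_completion[OF hb] integral_completion[OF hb])
  have ae: "AE z in lebesgue. f (fst z) * k z = ?h z"
    using AE_lebesgue_cylinders(1)[OF f'(3)] by eventually_elim simp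
  have fk: "(\<lambda>z. f (fst z) * k z) \<in> borel_measurable lebesgue"
    using measurable_compose[OF measurable_lebesgue_projections(1) borel_measurable_integrable[OF f]]
    by (rule borel_measurable_times) (use k in \<open>auto intro: measurable_completion\<close>)
  show "integrable lebesgue (\<lambda>z. f (fst z) * k z)"
    using integrable_cong_AE[OF fk _ ae] h1 by auto
  show "(LINT z|lebesgue. f (fst z) * k z) = c * integral\<^sup>L lebesgue f"
    using integral_cong_AE[OF fk _ ae] h1 by auto
qed

lemma lebesgue_fubini_product:
  fixes f :: "'a::euclidean_space \<Rightarrow> real" and g :: "'b::euclidean_space \<Rightarrow> real"
  assumes f: "integrable lebesgue f" and g: "integrable lebesgue g"
  shows "integrable lebesgue (\<lambda>z. f (fst z) * g (snd z))"
    and "(LINT z|lebesgue. f (fst z) * g (snd z)) = integral\<^sup>L lebesgue f * integral\<^sup>L lebesgue g"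
proof -
  obtain g' where g': "g' \<in> borel_measurable borel" "integrable lborel g'"
    "AE x in lebesgue. g x = g' x" "integral\<^sup>L lborel g' = integral\<^sup>L lebesgue g"
    using lebesgue_integrable_borel_version[OF g] .
  have "(\<lambda>z::'a \<times> 'b. g' (snd z)) \<in> borel_measurable borel"
    using g'(1) by (intro measurable_compose[OF _ g'(1)] borel_measurable_continuous_onI continuous_intros)
  note fub = lebesgue_fubini_constant_marginal[OF f this, of "integral\<^sup>L lborel g'" "LINT y|lborel. \<bar>g' y\<bar>"]
  have ae: "AE z in lebesgue. f (fst z) * g (snd z) = f (fst z) * g' (snd z)"
    using AE_lebesgue_cylinders(2)[OF g'(3)] by eventually_elim simp
  have fg: "(\<lambda>z. f (fst z) * g (snd z)) \<in> borel_measurable lebesgue"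
    by (intro borel_measurable_times measurable_compose[OF measurable_lebesgue_projections(1)]
        measurable_compose[OF measurable_lebesgue_projections(2)]) (use f g in auto)
  have fub1: "integrable lebesgue (\<lambda>z. f (fst z) * g' (snd z))"
    using fub(1) g'(2) by simp
  show "integrable lebesgue (\<lambda>z. f (fst z) * g (snd z))"
    using integrable_cong_AE[OF fg _ ae] fub1 by auto
  show "(LINT z|lebesgue. f (fst z) * g (snd z)) = integral\<^sup>L lebesgue f * integral\<^sup>L lebesgue g"
    using integral_cong_AE[OF fg _ ae] fub1 fub(2) g'(2,4) by auto
qed

lemma lebesgue_fubini_ball:
  fixes f :: "'a::euclidean_space \<Rightarrow> real"
  assumes f: "integrable lebesgue f" and r: "0 \<le> r"
  shows "integrable lebesgue (\<lambda>z. f (fst z) * indicator {z. dist (fst z) (snd z) < r} z)"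
    and "(LINT z|lebesgue. f (fst z) * indicator {z. dist (fst z) (snd z) < r} z)
      = measure lborel (ball (0::'a) r) * integral\<^sup>L lebesgue f"
proof -
  let ?k = "indicator {z::'a \<times> 'a. dist (fst z) (snd z) < r} :: 'a \<times> 'a \<Rightarrow> real"
  have "open {z::'a \<times> 'a. dist (fst z) (snd z) < r}"
    by (intro open_Collect_less continuous_intros)
  then have k: "?k \<in> borel_measurable borel" by auto
  have eq: "?k (x, y) = indicator (ball x r) y" for x y
    by (auto simp: indicator_def)
  have "integrable lborel (\<lambda>y. ?k (x, y))" for x
    unfolding eq by (rule integrable_real_indicator) (use emeasure_bounded_finite[OF bounded_ball] in auto)
  moreover have "(LINT y|lborel. ?k (x, y)) = measure lborel (ball (0::'a) r)" for x
    unfolding eq using r by (simp add: content_ball)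
  moreover have "(LINT y|lborel. \<bar>?k (x, y)\<bar>) = measure lborel (ball (0::'a) r)" for x
    unfolding eq using r by (simp add: content_ball)
  ultimately show "integrable lebesgue (\<lambda>z. f (fst z) * indicator {z. dist (fst z) (snd z) < r} z)"
    "(LINT z|lebesgue. f (fst z) * indicator {z. dist (fst z) (snd z) < r} z)
      = measure lborel (ball (0::'a) r) * integral\<^sup>L lebesgue f"
    using lebesgue_fubini_constant_marginal[OF f k] by auto
qed

section \<open>The energy space as a vector lattice\<close>

lemma affine_nonneg_imp_slope_zero:
  fixes a b :: real
  assumes "\<And>t. 0 \<le> a + t * b"
  shows "b = 0"
proof (rule ccontr)
  assume "b \<noteq> 0"
  then show False using assms[of "- (a + 1) / b"] by simp
qed

abbreviation pos_part :: "('a \<Rightarrow> real) \<Rightarrow> 'a \<Rightarrow> real" where "pos_part u \<equiv> (\<lambda>x. max (u x) 0)"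
abbreviation neg_part :: "('a \<Rightarrow> real) \<Rightarrow> 'a \<Rightarrow> real" where "neg_part u \<equiv> (\<lambda>x. max (- u x) 0)"

lemma set_integrable_mult_square_integrable:
  fixes f g :: "'b \<Rightarrow> real"
  assumes f: "set_borel_measurable M A f" "set_integrable M A (\<lambda>x. (f x)\<^sup>2)"
    and g: "set_borel_measurable M A g" "set_integrable M A (\<lambda>x. (g x)\<^sup>2)"
  shows "set_integrable M A (\<lambda>x. f x * g x)"
proof -
  have *: "indicator A x *\<^sub>R (f x * g x) = (indicator A x *\<^sub>R f x) * (indicator A x *\<^sub>R g x)" for x
    by (auto simp: indicator_def)
  have le: "\<bar>a * b\<bar> \<le> a\<^sup>2 + b\<^sup>2" for a b :: real
  proof -
    have "0 \<le> (\<bar>a\<bar> - \<bar>b\<bar>)\<^sup>2 + a\<^sup>2 + b\<^sup>2" by simp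
    then show ?thesis by (simp add: power2_diff abs_mult)
  qed
  have "integrable M (\<lambda>x. indicator A x *\<^sub>R (f x)\<^sup>2 + indicator A x *\<^sub>R (g x)\<^sup>2)"
    using f g by (auto simp: set_integrable_def)
  moreover have "(\<lambda>x. indicator A x *\<^sub>R (f x * g x)) \<in> borel_measurable M"
    unfolding * using f g by (auto simp: set_borel_measurable_def)
  ultimately show ?thesis
    unfolding set_integrable_def
    by (rule Bochner_Integration.integrable_bound) (auto simp: indicator_def intro: le)
qed

lemma square_integrable_lincomb:
  fixes f g :: "'b \<Rightarrow> real"
  assumes f: "set_borel_measurable M A f" "set_integrable M A (\<lambda>x. (f x)\<^sup>2)"
    and g: "set_borel_measurable M A g" "set_integrable M A (\<lambda>x. (g x)\<^sup>2)"
  shows "set_borel_measurable M A (\<lambda>x. a * f x + b * g x)"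
    and "set_integrable M A (\<lambda>x. (a * f x + b * g x)\<^sup>2)"
proof -
  have *: "indicator A x *\<^sub>R (a * f x + b * g x) =
      a * (indicator A x *\<^sub>R f x) + b * (indicator A x *\<^sub>R g x)" for x
    by (auto simp: indicator_def)
  show "set_borel_measurable M A (\<lambda>x. a * f x + b * g x)"
    using f g unfolding set_borel_measurable_def * by auto
  have "(a * f x + b * g x)\<^sup>2 = a\<^sup>2 * (f x)\<^sup>2 + 2 * a * b * (f x * g x) + b\<^sup>2 * (g x)\<^sup>2" for x
    by (simp add: power2_eq_square algebra_simps)
  then show "set_integrable M A (\<lambda>x. (a * f x + b * g x)\<^sup>2)"
    using f g set_integrable_mult_square_integrable[OF f g] by simp
qed

locale nonlocal_dirichlet =
  fixes \<Omega> :: "'a::euclidean_space set" and K :: "'a \<Rightarrow> real" and s c :: real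
  assumes open_domain: "open \<Omega>" and bounded_domain: "bounded \<Omega>"
    and s_pos: "0 < s" and c_pos: "0 < c"
    and kernel_lower: "x \<noteq> 0 \<Longrightarrow> c * norm x powr (- (real DIM('a) + 2 * s)) \<le> K x"
begin

abbreviation Q :: "('a \<times> 'a) set" where "Q \<equiv> Q_set \<Omega>"
abbreviation X0 :: "('a \<Rightarrow> real) set" where "X0 \<equiv> X0_space K \<Omega>"

definition wdiff :: "('a \<Rightarrow> real) \<Rightarrow> 'a \<times> 'a \<Rightarrow> real" where
  "wdiff u z = (u (fst z) - u (snd z)) * sqrt (K (fst z - snd z))"

definition form :: "('a \<Rightarrow> real) \<Rightarrow> ('a \<Rightarrow> real) \<Rightarrow> real" where
  "form u v = (LINT z:Q|lebesgue. wdiff u z * wdiff v z)"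

definition ip :: "('a \<Rightarrow> real) \<Rightarrow> ('a \<Rightarrow> real) \<Rightarrow> real" where
  "ip u v = (LINT x:\<Omega>|lebesgue. u x * v x)"

definition mass :: "('a \<Rightarrow> real) \<Rightarrow> real" where
  "mass u = (LINT x:\<Omega>|lebesgue. u x)"

lemma kernel_pos: "x \<noteq> 0 \<Longrightarrow> 0 < K x"
  by (rule less_le_trans[OF _ kernel_lower]) (use c_pos in auto)

text \<open>
  Splitting the kernel into two square roots makes the bilinear form an \<open>L\<^sup>2\<close> inner product, and the
  measurability built into the space \<open>X0\<close> is that of these weighted differences. On the diagonal
  the value \<open>K 0\<close> is arbitrary, but there the differences vanish.
\<close>
lemma wdiff_mult:
  "wdiff u z * wdiff v z = (u (fst z) - u (snd z)) * (v (fst z) - v (snd z)) * K (fst z - snd z)"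
proof (cases "fst z = snd z")
  case False
  then have "sqrt (K (fst z - snd z)) * sqrt (K (fst z - snd z)) = K (fst z - snd z)"
    using kernel_pos[of "fst z - snd z"] by simp
  then show ?thesis unfolding wdiff_def by (metis (no_types, opaque_lifting) mult.assoc mult.left_commute)
qed (simp add: wdiff_def)

lemma open_Q: "open Q"
  unfolding Q_set_def using open_domain by (intro open_Compl closed_Times) (auto simp: closed_def)

lemma sets_domain [measurable, simp]: "\<Omega> \<in> sets lebesgue" "Q \<in> sets lebesgue"
  using open_domain open_Q by auto

lemma X0_iff:
  "u \<in> X0 \<longleftrightarrow> u \<in> borel_measurable lebesgue \<and> set_integrable lebesgue \<Omega> (\<lambda>x. (u x)\<^sup>2) \<and>
     set_borel_measurable lebesgue Q (wdiff u) \<and> set_integrable lebesgue Q (\<lambda>z. (wdiff u z)\<^sup>2) \<and>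
     (AE x in lebesgue. x \<notin> \<Omega> \<longrightarrow> u x = 0)"
proof -
  have *: "wdiff u = (\<lambda>(x, y). (u x - u y) * sqrt (K (x - y)))"
    by (auto simp: wdiff_def fun_eq_iff)
  have "set_borel_measurable lebesgue \<Omega> u" if "u \<in> borel_measurable lebesgue"
    unfolding set_borel_measurable_def using that by (intro borel_measurable_scaleR) auto
  then show ?thesis
    unfolding X0_space_def X_space_def L2_on_def * by auto
qed

lemma X0_domain_measurable: "u \<in> X0 \<Longrightarrow> set_borel_measurable lebesgue \<Omega> u"
  unfolding set_borel_measurable_def X0_iff by (intro borel_measurable_scaleR) auto

lemma X0_lincomb:
  assumes "u \<in> X0" "v \<in> X0"
  shows "(\<lambda>x. a * u x + b * v x) \<in> X0"
proof -
  have *: "wdiff (\<lambda>x. a * u x + b * v x) = (\<lambda>z. a * wdiff u z + b * wdiff v z)"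
    by (auto simp: wdiff_def algebra_simps)
  have "AE x in lebesgue. x \<notin> \<Omega> \<longrightarrow> u x = 0" "AE x in lebesgue. x \<notin> \<Omega> \<longrightarrow> v x = 0"
    using assms by (auto simp: X0_iff)
  then have "AE x in lebesgue. x \<notin> \<Omega> \<longrightarrow> a * u x + b * v x = 0"
    by eventually_elim simp
  then show ?thesis
    using assms square_integrable_lincomb[of lebesgue Q "wdiff u" "wdiff v" a b]
      square_integrable_lincomb(2)[of lebesgue \<Omega> u v a b]
      X0_domain_measurable[OF assms(1)] X0_domain_measurable[OF assms(2)]
    unfolding X0_iff * by auto
qed

lemma X0_scale: "u \<in> X0 \<Longrightarrow> (\<lambda>x. a * u x) \<in> X0"
  using X0_lincomb[of u u a 0] by simp

text \<open>
  Taking absolute values contracts differences. For measurability, the weighted difference of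
  \<open>\<bar>u\<bar>\<close> is written as that of \<open>u\<close> times a ratio of differences, which involves
  \<open>u\<close> only; the factor with the kernel is then measurable because \<open>u\<close> belongs to \<open>X0\<close>.
\<close>
lemma X0_abs:
  assumes "u \<in> X0"
  shows "(\<lambda>x. \<bar>u x\<bar>) \<in> X0"
proof -
  let ?q = "\<lambda>z. if u (fst z) = u (snd z) then 0
              else (\<bar>u (fst z)\<bar> - \<bar>u (snd z)\<bar>) / (u (fst z) - u (snd z))"
  have u: "u \<in> borel_measurable lebesgue" using assms by (simp add: X0_iff)
  have u1 [measurable]: "(\<lambda>z. u (fst z)) \<in> borel_measurable (lebesgue :: ('a \<times> 'a) measure)"
    by (rule measurable_compose[OF measurable_lebesgue_projections(1) u])
  have u2 [measurable]: "(\<lambda>z. u (snd z)) \<in> borel_measurable (lebesgue :: ('a \<times> 'a) measure)"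
    by (rule measurable_compose[OF measurable_lebesgue_projections(2) u])
  have q: "?q \<in> borel_measurable lebesgue" by measurable
  have "indicator Q z *\<^sub>R wdiff (\<lambda>x. \<bar>u x\<bar>) z = ?q z * (indicator Q z *\<^sub>R wdiff u z)" for z
    by (simp add: wdiff_def)
  moreover have "(\<lambda>z. ?q z * (indicator Q z *\<^sub>R wdiff u z)) \<in> borel_measurable lebesgue"
    using assms by (intro borel_measurable_times[OF q]) (auto simp: X0_iff set_borel_measurable_def)
  ultimately have m: "set_borel_measurable lebesgue Q (wdiff (\<lambda>x. \<bar>u x\<bar>))"
    unfolding set_borel_measurable_def by presburger
  have le: "(wdiff (\<lambda>x. \<bar>u x\<bar>) z)\<^sup>2 \<le> (wdiff u z)\<^sup>2" for z
  proof -
    have "\<bar>\<bar>u (fst z)\<bar> - \<bar>u (snd z)\<bar>\<bar> \<le> \<bar>u (fst z) - u (snd z)\<bar>" by linarith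
    then have "\<bar>wdiff (\<lambda>x. \<bar>u x\<bar>) z\<bar> \<le> \<bar>wdiff u z\<bar>"
      by (auto simp: wdiff_def abs_mult intro: mult_right_mono)
    then show ?thesis by (rule abs_le_square_iff[THEN iffD1])
  qed
  have "(\<lambda>z. indicator Q z *\<^sub>R (wdiff (\<lambda>x. \<bar>u x\<bar>) z)\<^sup>2) =
      (\<lambda>z. (indicator Q z *\<^sub>R wdiff (\<lambda>x. \<bar>u x\<bar>) z)\<^sup>2)"
    by (auto simp: indicator_def)
  then have m2: "(\<lambda>z. indicator Q z *\<^sub>R (wdiff (\<lambda>x. \<bar>u x\<bar>) z)\<^sup>2) \<in> borel_measurable lebesgue"
    using m unfolding set_borel_measurable_def by auto
  have i: "set_integrable lebesgue Q (\<lambda>z. (wdiff (\<lambda>x. \<bar>u x\<bar>) z)\<^sup>2)"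
    unfolding set_integrable_def
    by (rule Bochner_Integration.integrable_bound[OF _ m2, of "\<lambda>z. indicator Q z *\<^sub>R (wdiff u z)\<^sup>2"])
      (use assms le in \<open>auto simp: X0_iff set_integrable_def indicator_def\<close>)
  show ?thesis
    using assms m i by (auto simp: X0_iff)
qed

lemma form_integrable:
  assumes "u \<in> X0" "v \<in> X0"
  shows "set_integrable lebesgue Q (\<lambda>z. wdiff u z * wdiff v z)"
  using assms by (auto simp: X0_iff intro!: set_integrable_mult_square_integrable)

lemma ip_integrable:
  assumes "u \<in> X0" "v \<in> X0"
  shows "set_integrable lebesgue \<Omega> (\<lambda>x. u x * v x)"
  using assms X0_domain_measurable by (auto simp: X0_iff intro!: set_integrable_mult_square_integrable)

lemma form_lincomb:
  assumes "u \<in> X0" "v \<in> X0" "w \<in> X0"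
  shows "form (\<lambda>x. a * u x + b * v x) w = a * form u w + b * form v w"
proof -
  have "wdiff (\<lambda>x. a * u x + b * v x) z * wdiff w z = a * (wdiff u z * wdiff w z) + b * (wdiff v z * wdiff w z)" for z
    by (auto simp: wdiff_def algebra_simps)
  then show ?thesis
    unfolding form_def using form_integrable[OF assms(1,3)] form_integrable[OF assms(2,3)] by simp
qed

lemma form_commute: "form u v = form v u"
  by (simp add: form_def mult.commute)

lemma form_nonneg: "0 \<le> form u u"
  unfolding form_def set_lebesgue_integral_def by (intro integral_nonneg_AE) auto

lemma ip_lincomb:
  assumes "u \<in> X0" "v \<in> X0" "w \<in> X0"
  shows "ip (\<lambda>x. a * u x + b * v x) w = a * ip u w + b * ip v w"
proof -
  have "(a * u x + b * v x) * w x = a * (u x * w x) + b * (v x * w x)" for x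
    by (auto simp: algebra_simps)
  then show ?thesis
    unfolding ip_def using ip_integrable[OF assms(1,3)] ip_integrable[OF assms(2,3)] by simp
qed

lemma ip_commute: "ip u v = ip v u"
  by (simp add: ip_def mult.commute)

lemma ip_nonneg: "0 \<le> ip u u"
  unfolding ip_def set_lebesgue_integral_def by (intro integral_nonneg_AE) auto

lemma lincomb_square:
  assumes "u \<in> X0" "v \<in> X0"
  shows "form (\<lambda>x. a * u x + b * v x) (\<lambda>x. a * u x + b * v x)
      = a\<^sup>2 * form u u + 2 * a * b * form u v + b\<^sup>2 * form v v"
    and "ip (\<lambda>x. a * u x + b * v x) (\<lambda>x. a * u x + b * v x)
      = a\<^sup>2 * ip u u + 2 * a * b * ip u v + b\<^sup>2 * ip v v"
proof -
  let ?w = "\<lambda>x. a * u x + b * v x"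
  have w: "?w \<in> X0" using assms by (rule X0_lincomb)
  have "form ?w ?w = a * form ?w u + b * form ?w v"
    using form_lincomb[OF assms w] by (simp add: form_commute)
  also have "\<dots> = a\<^sup>2 * form u u + 2 * a * b * form u v + b\<^sup>2 * form v v"
    using assms by (simp add: form_lincomb form_commute[of v u] power2_eq_square algebra_simps)
  finally show "form ?w ?w = a\<^sup>2 * form u u + 2 * a * b * form u v + b\<^sup>2 * form v v" .
  have "ip ?w ?w = a * ip ?w u + b * ip ?w v"
    using ip_lincomb[OF assms w] by (simp add: ip_commute)
  also have "\<dots> = a\<^sup>2 * ip u u + 2 * a * b * ip u v + b\<^sup>2 * ip v v"
    using assms by (simp add: ip_lincomb ip_commute[of v u] power2_eq_square algebra_simps)
  finally show "ip ?w ?w = a\<^sup>2 * ip u u + 2 * a * b * ip u v + b\<^sup>2 * ip v v" .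
qed

lemma X0_norm_sq: "(X0_norm K \<Omega> u)\<^sup>2 = form u u"
proof -
  have "(LINT z:Q|lebesgue. \<bar>u (fst z) - u (snd z)\<bar>\<^sup>2 * K (fst z - snd z)) = form u u"
    unfolding form_def wdiff_mult by (simp add: power2_eq_square)
  then show ?thesis
    unfolding X0_norm_def using form_nonneg[of u] by simp
qed

lemma lambda1_eq: "lambda1 K \<Omega> = Inf {form u u | u. u \<in> X0 \<and> ip u u = 1}"
  unfolding lambda1_def X0_norm_sq by (simp add: ip_def power2_eq_square)

lemma rayleigh:
  assumes "u \<in> X0"
  shows "lambda1 K \<Omega> * ip u u \<le> form u u"
proof (cases "ip u u = 0")
  case False
  define a where "a = 1 / sqrt (ip u u)"
  have pos: "0 < ip u u" using False ip_nonneg[of u] by simp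
  then have a: "a\<^sup>2 * ip u u = 1" by (simp add: a_def power_divide)
  let ?v = "\<lambda>x. a * u x"
  have v: "?v \<in> X0" "form ?v ?v = a\<^sup>2 * form u u" "ip ?v ?v = a\<^sup>2 * ip u u"
    using X0_scale[OF assms] lincomb_square[OF assms assms, of a 0] by simp_all
  have "lambda1 K \<Omega> \<le> form ?v ?v"
    unfolding lambda1_eq
  proof (rule cInf_lower)
    show "form ?v ?v \<in> {form u u |u. u \<in> X0 \<and> ip u u = 1}"
      using v(1) v(3)[unfolded a] by blast
    show "bdd_below {form u u |u. u \<in> X0 \<and> ip u u = 1}"
      by (rule bdd_belowI[of _ 0]) (auto simp: form_nonneg)
  qed
  then have "lambda1 K \<Omega> * ip u u \<le> a\<^sup>2 * form u u * ip u u"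
    unfolding v(2) using pos by (intro mult_right_mono) auto
  also have "\<dots> = form u u" using a by (metis mult.assoc mult.commute mult_1)
  finally show ?thesis .
qed (simp add: form_nonneg)

lemma near_minimiser:
  assumes "u \<in> X0" "0 < ip u u" "0 < \<epsilon>"
  obtains v where "v \<in> X0" "ip v v = 1" "form v v < lambda1 K \<Omega> + \<epsilon>"
proof -
  define a where "a = 1 / sqrt (ip u u)"
  have "a\<^sup>2 * ip u u = 1" using assms by (simp add: a_def power_divide)
  then have "ip (\<lambda>x. a * u x) (\<lambda>x. a * u x) = 1"
    using lincomb_square(2)[OF assms(1) assms(1), of a 0] by simp
  then have "{form u u | u. u \<in> X0 \<and> ip u u = 1} \<noteq> {}"
    using X0_scale[OF assms(1), of a] by auto
  then have "\<exists>y \<in> {form u u | u. u \<in> X0 \<and> ip u u = 1}. y < lambda1 K \<Omega> + \<epsilon>"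
    using assms(3) by (intro cInf_lessD) (simp_all add: lambda1_eq)
  then show thesis using that by blast
qed

lemma X0_integrable:
  assumes "u \<in> X0"
  shows "set_integrable lebesgue \<Omega> u"
proof -
  have "\<Omega> \<in> lmeasurable" using open_domain bounded_domain by (simp add: lmeasurable_open)
  then have "integrable lebesgue (\<lambda>x. indicator \<Omega> x *\<^sub>R (1::real))"
    by (simp add: fmeasurable_def less_top)
  moreover have "integrable lebesgue (\<lambda>x. indicator \<Omega> x *\<^sub>R (u x)\<^sup>2)"
    using assms by (auto simp: X0_iff set_integrable_def)
  ultimately have "integrable lebesgue (\<lambda>x. indicator \<Omega> x *\<^sub>R (1::real) + indicator \<Omega> x *\<^sub>R (u x)\<^sup>2)"
    by (rule Bochner_Integration.integrable_add)
  moreover have "(\<lambda>x. indicator \<Omega> x *\<^sub>R u x) \<in> borel_measurable lebesgue"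
    using X0_domain_measurable[OF assms] by (simp add: set_borel_measurable_def)
  moreover have "\<bar>b\<bar> \<le> 1 + b\<^sup>2" for b :: real
    using sum_squares_bound[of 1 "\<bar>b\<bar>"] by simp
  ultimately show ?thesis
    unfolding set_integrable_def
    by (elim Bochner_Integration.integrable_bound) (auto simp: indicator_def)
qed

lemma mass_lincomb:
  assumes "u \<in> X0" "v \<in> X0"
  shows "mass (\<lambda>x. a * u x + b * v x) = a * mass u + b * mass v"
  unfolding mass_def using X0_integrable[OF assms(1)] X0_integrable[OF assms(2)] by simp

lemma mass_mono:
  assumes "u \<in> X0" "v \<in> X0" "\<And>x. u x \<le> v x"
  shows "mass u \<le> mass v"
  unfolding mass_def using X0_integrable[OF assms(1)] X0_integrable[OF assms(2)] assms(3)
  by (intro set_integral_mono) auto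

text \<open>
  The degenerate case of the Cauchy-Schwarz inequality, here for the energy and next for the
  \<open>L\<^sup>2\<close> product: it lets a vanishing part of a solution drop out of the weak equation.
\<close>
lemma form_null:
  assumes "u \<in> X0" "v \<in> X0" "form u u = 0"
  shows "form u v = 0"
proof -
  have "2 * form u v = 0"
  proof (rule affine_nonneg_imp_slope_zero)
    show "0 \<le> form v v + t * (2 * form u v)" for t
      using form_nonneg[of "\<lambda>x. 1 * v x + t * u x"] lincomb_square(1)[OF assms(2,1), of 1 t] assms(3)
      by (simp add: form_commute[of v u] mult_ac)
  qed
  then show ?thesis by simp
qed

lemma ip_null:
  assumes "u \<in> X0" "v \<in> X0" "ip u u = 0"
  shows "ip u v = 0"
proof -
  have "2 * ip u v = 0"
  proof (rule affine_nonneg_imp_slope_zero)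
    show "0 \<le> ip v v + t * (2 * ip u v)" for t
      using ip_nonneg[of "\<lambda>x. 1 * v x + t * u x"] lincomb_square(2)[OF assms(2,1), of 1 t] assms(3)
      by (simp add: ip_commute[of v u] mult_ac)
  qed
  then show ?thesis by simp
qed

lemma ip_eq_0D:
  assumes "u \<in> X0" "ip u u = 0"
  shows "AE x in lebesgue. u x = 0"
proof -
  have "AE x in lebesgue. indicator \<Omega> x *\<^sub>R (u x * u x) = 0"
    using assms ip_integrable[OF assms(1) assms(1)]
    by (subst integral_nonneg_eq_0_iff_AE[symmetric]) (auto simp: ip_def set_lebesgue_integral_def set_integrable_def)
  moreover have "AE x in lebesgue. x \<notin> \<Omega> \<longrightarrow> u x = 0" using assms by (simp add: X0_iff)
  ultimately show ?thesis
    by eventually_elim (auto simp: indicator_def split: if_splits)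
qed

lemma X0_pos_part: "u \<in> X0 \<Longrightarrow> pos_part u \<in> X0"
proof -
  assume "u \<in> X0"
  moreover have "pos_part u = (\<lambda>x. 1/2 * u x + 1/2 * \<bar>u x\<bar>)" by (auto simp: max_def)
  ultimately show ?thesis using X0_lincomb[OF _ X0_abs, of u u "1/2" "1/2"] by simp
qed

lemma X0_neg_part: "u \<in> X0 \<Longrightarrow> neg_part u \<in> X0"
  using X0_pos_part[OF X0_scale[of u "-1"]] by simp

lemma abs_mass_le:
  assumes "u \<in> X0"
  shows "\<bar>mass u\<bar> \<le> mass (\<lambda>x. \<bar>u x\<bar>)"
proof -
  have "mass u \<le> mass (\<lambda>x. \<bar>u x\<bar>)"
    using assms by (intro mass_mono X0_abs) auto
  moreover have "mass (\<lambda>x. -1 * u x) \<le> mass (\<lambda>x. \<bar>u x\<bar>)"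
    using assms by (intro mass_mono X0_abs X0_scale) auto
  moreover have "mass (\<lambda>x. -1 * u x) = - mass u"
    using mass_lincomb[OF assms assms, of "-1" 0] by simp
  ultimately show ?thesis by linarith
qed

section \<open>Two consequences of the lower bound on the kernel\<close>

lemma kernel_bounded_below_near:
  assumes "x \<noteq> y" "dist x y \<le> R"
  shows "c * R powr (- (real DIM('a) + 2 * s)) \<le> K (x - y)"
proof -
  have "R powr (- (real DIM('a) + 2 * s)) \<le> norm (x - y) powr (- (real DIM('a) + 2 * s))"
    using assms s_pos by (intro powr_mono2') (auto simp: dist_norm)
  then have "c * R powr (- (real DIM('a) + 2 * s)) \<le> c * norm (x - y) powr (- (real DIM('a) + 2 * s))"
    using c_pos by simp
  also have "\<dots> \<le> K (x - y)" using assms by (intro kernel_lower) auto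
  finally show ?thesis .
qed

lemma kernel_bounded_below_domain:
  obtains \<kappa> where "0 < \<kappa>" "\<And>x y. x \<in> \<Omega> \<Longrightarrow> y \<in> \<Omega> \<Longrightarrow> x \<noteq> y \<Longrightarrow> \<kappa> \<le> K (x - y)"
proof -
  obtain B where B: "\<And>x. x \<in> \<Omega> \<Longrightarrow> norm x \<le> B"
    using bounded_domain by (auto simp: bounded_iff)
  define R where "R = 2 * \<bar>B\<bar> + 1"
  have R: "dist x y \<le> R" if "x \<in> \<Omega>" "y \<in> \<Omega>" for x y
    using B[OF that(1)] B[OF that(2)] norm_triangle_ineq4[of x y] by (simp add: R_def dist_norm)
  show thesis
    by (rule that[of "c * R powr (- (real DIM('a) + 2 * s))"])
      (use c_pos R kernel_bounded_below_near in \<open>auto simp: R_def\<close>)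
qed

text \<open>
  Pointwise, \<open>(a - b)\<^sup>2 - (\<bar>a\<bar> - \<bar>b\<bar>)\<^sup>2 = 2 (\<bar>a b\<bar> - a b) \<ge> 0\<close>. On \<open>\<Omega> \<times> \<Omega>\<close> off
  the diagonal the kernel is at least \<open>\<kappa>\<close>, and on the diagonal both sides vanish. Over
  \<open>\<Omega> \<times> \<Omega>\<close> the right-hand side integrates to twice the difference of the squared masses. This is the quantitative form of the nonlocal interaction between the two parts of \<open>w\<close>.
\<close>
lemma abs_energy_gap:
  obtains \<kappa> where "0 < \<kappa>"
    "\<And>w. w \<in> X0 \<Longrightarrow> form (\<lambda>x. \<bar>w x\<bar>) (\<lambda>x. \<bar>w x\<bar>) + 2 * \<kappa> * ((mass (\<lambda>x. \<bar>w x\<bar>))\<^sup>2 - (mass w)\<^sup>2) \<le> form w w"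
proof -
  obtain \<kappa> where \<kappa>: "0 < \<kappa>" "\<And>x y. x \<in> \<Omega> \<Longrightarrow> y \<in> \<Omega> \<Longrightarrow> x \<noteq> y \<Longrightarrow> \<kappa> \<le> K (x - y)"
    using kernel_bounded_below_domain by blast
  show thesis
  proof (rule that[OF \<kappa>(1)])
    fix w assume w: "w \<in> X0"
    let ?a = "\<lambda>x. \<bar>w x\<bar>"
    let ?f = "\<lambda>x. indicator \<Omega> x *\<^sub>R w x" and ?g = "\<lambda>x. indicator \<Omega> x *\<^sub>R \<bar>w x\<bar>"
    let ?G = "\<lambda>z. 2 * \<kappa> * (?g (fst z) * ?g (snd z) - ?f (fst z) * ?f (snd z))"
    let ?H = "\<lambda>z. indicator Q z *\<^sub>R (wdiff w z * wdiff w z) - indicator Q z *\<^sub>R (wdiff ?a z * wdiff ?a z)"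
    have a: "?a \<in> X0" using w by (rule X0_abs)
    have f: "integrable lebesgue ?f" "integral\<^sup>L lebesgue ?f = mass w"
      using X0_integrable[OF w] by (auto simp: set_integrable_def mass_def set_lebesgue_integral_def)
    have g: "integrable lebesgue ?g" "integral\<^sup>L lebesgue ?g = mass ?a"
      using X0_integrable[OF a] by (auto simp: set_integrable_def mass_def set_lebesgue_integral_def)
    note ff = lebesgue_fubini_product[OF f(1) f(1)] and gg = lebesgue_fubini_product[OF g(1) g(1)]
    have Gi: "integrable lebesgue ?G"
      by (intro integrable_mult_right Bochner_Integration.integrable_diff ff(1) gg(1))
    have G: "integral\<^sup>L lebesgue ?G = 2 * \<kappa> * ((mass ?a)\<^sup>2 - (mass w)\<^sup>2)"
      using ff gg f(2) g(2) by (simp add: power2_eq_square)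
    have hw: "integrable lebesgue (\<lambda>z. indicator Q z *\<^sub>R (wdiff w z * wdiff w z))"
      and ha: "integrable lebesgue (\<lambda>z. indicator Q z *\<^sub>R (wdiff ?a z * wdiff ?a z))"
      using form_integrable[OF w w] form_integrable[OF a a] by (auto simp: set_integrable_def)
    have Hi: "integrable lebesgue ?H"
      by (intro Bochner_Integration.integrable_diff hw ha)
    have H: "integral\<^sup>L lebesgue ?H = form w w - form ?a ?a"
      using hw ha by (simp add: form_def set_lebesgue_integral_def)
    have "?G z \<le> ?H z" for z
    proof -
      obtain x y where z: "z = (x, y)" by (cases z)
      have "(w x - w y) * (w x - w y) - (\<bar>w x\<bar> - \<bar>w y\<bar>) * (\<bar>w x\<bar> - \<bar>w y\<bar>)
          = 2 * (\<bar>w x\<bar> * \<bar>w y\<bar> - w x * w y)"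
        by (simp add: algebra_simps)
      moreover have "?H z = indicator Q z * (((w x - w y) * (w x - w y)
          - (\<bar>w x\<bar> - \<bar>w y\<bar>) * (\<bar>w x\<bar> - \<bar>w y\<bar>)) * K (x - y))"
        unfolding wdiff_mult z fst_conv snd_conv left_diff_distrib real_scaleR_def
        by (simp only: right_diff_distrib)
      ultimately have "?H z = indicator Q z * (2 * (\<bar>w x\<bar> * \<bar>w y\<bar> - w x * w y) * K (x - y))"
        by (simp only:)
      moreover have nn: "0 \<le> \<bar>w x\<bar> * \<bar>w y\<bar> - w x * w y"
        by (metis abs_ge_self abs_mult diff_ge_0_iff_ge)
      moreover have "\<kappa> * (2 * (\<bar>w x\<bar> * \<bar>w y\<bar> - w x * w y)) \<le> K (x - y) * (2 * (\<bar>w x\<bar> * \<bar>w y\<bar> - w x * w y))"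
        if "x \<in> \<Omega>" "y \<in> \<Omega>" "x \<noteq> y"
        using \<kappa>(2)[OF that] nn by (intro mult_right_mono) auto
      moreover have "0 \<le> 2 * (\<bar>w x\<bar> * \<bar>w y\<bar> - w x * w y) * K (x - y)"
        using nn kernel_pos[of "x - y"] by (cases "x = y") auto
      ultimately show ?thesis
        by (cases "x \<in> \<Omega> \<and> y \<in> \<Omega>"; cases "x = y") (auto simp: z Q_set_def mult_ac indicator_def)
    qed
    then have "integral\<^sup>L lebesgue ?G \<le> integral\<^sup>L lebesgue ?H"
      by (intro integral_mono Gi Hi)
    then show "form ?a ?a + 2 * \<kappa> * ((mass ?a)\<^sup>2 - (mass w)\<^sup>2) \<le> form w w"
      unfolding G H by simp
  qed
qed

text \<open>
  Integrate \<open>u(x)\<^sup>2 \<le> (u(x) - u(y))\<^sup>2 + 2 \<bar>u(x)\<bar> \<bar>u(y)\<bar>\<close> over \<open>x \<in> \<Omega>\<close>,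
  \<open>dist x y < r\<close>. The left side gives \<open>V \<integral>u\<^sup>2\<close> with \<open>V\<close> the volume of the ball of radius
  \<open>r\<close>, which is proportional to \<open>r powr n\<close>. In the first term on the right
  \<open>K \<ge> c r powr (- (n + 2 s))\<close>, so it is at most \<open>C = r powr (n + 2 s) / c\<close> times the energy,
  hence small relative to \<open>V\<close> when \<open>r\<close> is small; the last term is at most twice the squared \<open>L\<^sup>1\<close> norm.
\<close>
lemma nash_inequality:
  obtains \<delta> where "0 < \<delta>"
    "\<And>u. u \<in> X0 \<Longrightarrow> form u u \<le> M * ip u u \<Longrightarrow> \<delta> * ip u u \<le> (mass (\<lambda>x. \<bar>u x\<bar>))\<^sup>2"
proof -
  define n where "n = real DIM('a)"
  define b where "b = unit_ball_vol n"
  \<comment> \<open>This radius makes \<open>C (\<bar>M\<bar> + 1)\<close> exactly half of \<open>V\<close>, so that the energy term is absorbed.\<close>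
  define r where "r = (b * c / (2 * (\<bar>M\<bar> + 1))) powr (1 / (2 * s))"
  have b: "0 < b" by (simp add: b_def n_def)
  have r: "0 < r" using b c_pos by (simp add: r_def)
  define V where "V = measure lborel (ball (0::'a) r)"
  define C where "C = r powr (n + 2 * s) / c"
  have C: "0 < C" using r c_pos by (simp add: C_def)
  have V: "V = b * r powr n"
    using r by (simp add: V_def content_ball b_def n_def powr_realpow)
  have "r powr (2 * s) = b * c / (2 * (\<bar>M\<bar> + 1))"
    using s_pos b c_pos by (simp add: r_def powr_powr)
  then have "r powr (2 * s) * (\<bar>M\<bar> + 1) = b * c / 2"
    by (simp add: field_simps)
  moreover have "C * (\<bar>M\<bar> + 1) = r powr n * (r powr (2 * s) * (\<bar>M\<bar> + 1)) / c"
    by (simp add: C_def powr_add)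
  ultimately have "C * (\<bar>M\<bar> + 1) = r powr n * (b * c / 2) / c"
    by (simp only:)
  then have CM: "C * (\<bar>M\<bar> + 1) = V / 2"
    using c_pos by (simp add: V)
  have key: "V * ip u u \<le> C * form u u + 2 * (mass (\<lambda>x. \<bar>u x\<bar>))\<^sup>2" if u: "u \<in> X0" for u
  proof -
    let ?f = "\<lambda>x. indicator \<Omega> x *\<^sub>R \<bar>u x\<bar>"
    let ?F = "\<lambda>z. (indicator \<Omega> (fst z) *\<^sub>R (u (fst z) * u (fst z))) * indicator {z. dist (fst z) (snd z) < r} z"
    let ?G = "\<lambda>z. C * (indicator Q z *\<^sub>R (wdiff u z * wdiff u z)) + 2 * (?f (fst z) * ?f (snd z))"
    have f: "integrable lebesgue ?f" "integral\<^sup>L lebesgue ?f = mass (\<lambda>x. \<bar>u x\<bar>)"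
      using X0_integrable[OF X0_abs[OF u]] by (auto simp: set_integrable_def mass_def set_lebesgue_integral_def)
    note ff = lebesgue_fubini_product[OF f(1) f(1)]
    have uu: "integrable lebesgue (\<lambda>x. indicator \<Omega> x *\<^sub>R (u x * u x))"
      using ip_integrable[OF u u] by (simp add: set_integrable_def)
    have Fi: "integrable lebesgue ?F"
      and F: "integral\<^sup>L lebesgue ?F = V * ip u u"
      using lebesgue_fubini_ball[OF uu, of r] r by (simp_all add: V_def ip_def set_lebesgue_integral_def)
    have h: "integrable lebesgue (\<lambda>z. indicator Q z *\<^sub>R (wdiff u z * wdiff u z))"
      using form_integrable[OF u u] by (simp add: set_integrable_def)
    have Gi: "integrable lebesgue ?G"
      by (intro Bochner_Integration.integrable_add integrable_mult_right h ff(1))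
    have G: "integral\<^sup>L lebesgue ?G = C * form u u + 2 * (mass (\<lambda>x. \<bar>u x\<bar>))\<^sup>2"
      using h ff f(2) by (simp add: form_def set_lebesgue_integral_def power2_eq_square)
    have ae: "AE z in lebesgue. snd z \<notin> \<Omega> \<longrightarrow> u (snd z) = 0"
      using u by (intro AE_lebesgue_cylinders(2)) (simp add: X0_iff)
    have "AE z in lebesgue. ?F z \<le> ?G z"
      using ae
    proof eventually_elim
      fix z :: "'a \<times> 'a" assume out: "snd z \<notin> \<Omega> \<longrightarrow> u (snd z) = 0"
      obtain x y where z: "z = (x, y)" by (cases z)
      have nn: "0 \<le> wdiff u z * wdiff u z" by simp
      show "?F z \<le> ?G z"
      proof (cases "x \<in> \<Omega> \<and> dist x y < r")
        case True
        have zQ: "z \<in> Q" using True by (simp add: z Q_set_def)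
        have "(u x - u y) * (u x - u y) \<le> C * (wdiff u z * wdiff u z)"
        proof (cases "x = y")
          case False
          then have "c * r powr (- (n + 2 * s)) \<le> K (x - y)"
            unfolding n_def using True by (intro kernel_bounded_below_near) auto
          then have "c \<le> K (x - y) * r powr (n + 2 * s)"
            using r unfolding powr_minus by (simp add: pos_divide_le_eq flip: divide_inverse)
          then have "1 \<le> C * K (x - y)"
            using c_pos by (simp add: C_def field_simps)
          then have "(u x - u y) * (u x - u y) * 1 \<le> (u x - u y) * (u x - u y) * (C * K (x - y))"
            by (intro mult_left_mono) auto
          then show ?thesis unfolding wdiff_mult z by (simp add: mult_ac)
        qed (use C in simp)
        moreover have "u x * u x \<le> (u x - u y) * (u x - u y) + 2 * (\<bar>u x\<bar> * \<bar>u y\<bar>)"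
        proof -
          have "u x * u y \<le> \<bar>u x\<bar> * \<bar>u y\<bar>" by (metis abs_ge_self abs_mult)
          moreover have "0 \<le> u y * u y" by simp
          ultimately show ?thesis
            unfolding left_diff_distrib right_diff_distrib mult.commute[of "u y" "u x"] by linarith
        qed
        moreover have "?F z = u x * u x" using True by (simp add: z)
        moreover have "?G z = C * (wdiff u z * wdiff u z) + 2 * (\<bar>u x\<bar> * \<bar>u y\<bar>)"
        proof -
          have fx: "?f x = \<bar>u x\<bar>" and fy: "?f y = \<bar>u y\<bar>" using True out by (auto simp: z)
          show ?thesis using zQ unfolding z fst_conv snd_conv fx fy by simp
        qed
        ultimately show ?thesis by linarith
      next
        case False
        then have "?F z = 0" by (auto simp: z)
        moreover have "0 \<le> ?G z" using C by simp
        ultimately show ?thesis by linarith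
      qed
    qed
    then have "integral\<^sup>L lebesgue ?F \<le> integral\<^sup>L lebesgue ?G"
      by (intro integral_mono_AE Fi Gi)
    then show ?thesis unfolding F G .
  qed
  show thesis
  proof (rule that[of "V / 4"])
    show "0 < V / 4" using b r by (simp add: V)
    fix u assume u: "u \<in> X0" "form u u \<le> M * ip u u"
    have "form u u \<le> (\<bar>M\<bar> + 1) * ip u u"
      using u(2) by (rule order_trans) (auto intro!: mult_right_mono ip_nonneg)
    then have "C * form u u \<le> C * ((\<bar>M\<bar> + 1) * ip u u)"
      using C by simp
    also have "\<dots> = V / 2 * ip u u" using CM by (metis mult.assoc)
    finally show "V / 4 * ip u u \<le> (mass (\<lambda>x. \<bar>u x\<bar>))\<^sup>2"
      using key[OF u(1)] by simp
  qed
qed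

section \<open>Eigenfunctions of constant sign above the first eigenvalue\<close>

text \<open>
  Write \<open>E(w) = B(w, w) - \<lambda>\<^sub>1 \<integral>w\<^sup>2 \<ge> 0\<close>. For a normalised nonnegative \<open>p\<close> with
  \<open>E(p) \<le> \<epsilon>\<close> the eigenvalue equation gives, with \<open>g = \<gamma> - \<lambda>\<^sub>1\<close>, \<open>D = \<integral>u p\<close> and
  \<open>U = \<integral>u\<^sup>2\<close>,
  \<open>E(p - t u) \<le> \<epsilon> - 2 t g D + t\<^sup>2 g U\<close>.
  Nonnegativity of the left side for every \<open>t\<close> forces \<open>D\<close> to be small with \<open>\<epsilon>\<close>, so \<open>p\<close> and \<open>t u\<close>
  hardly overlap. By the energy gap \<open>E(p - t u)\<close> is then at least of order
  \<open>\<kappa> \<integral>p (t \<integral>u)\<close>, where \<open>\<integral>p\<close> is bounded below by the Nash inequality. For small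
  \<open>t\<close> and \<open>\<epsilon> \<le> t\<^sup>2\<close> this exceeds the upper bound, which is then at most
  \<open>t\<^sup>2 (1 + g U)\<close>.
\<close>
lemma no_nonneg_eigenfunction_above:
  assumes u: "u \<in> X0" "\<And>x. 0 \<le> u x" "0 < ip u u"
    and eigen: "\<And>v. v \<in> X0 \<Longrightarrow> form u v = \<gamma> * ip u v"
  shows "\<gamma> \<le> lambda1 K \<Omega>"
proof (rule ccontr)
  assume above: "\<not> \<gamma> \<le> lambda1 K \<Omega>"
  define g where "g = \<gamma> - lambda1 K \<Omega>"
  define L where "L = lambda1 K \<Omega>"
  define U where "U = ip u u"
  define B where "B = mass u"
  have g: "0 < g" using above by (simp add: g_def)
  have U: "0 < U" using u by (simp add: U_def)
  obtain \<kappa> where \<kappa>: "0 < \<kappa>" and gap: "\<And>w. w \<in> X0 \<Longrightarrow>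
      form (\<lambda>x. \<bar>w x\<bar>) (\<lambda>x. \<bar>w x\<bar>) + 2 * \<kappa> * ((mass (\<lambda>x. \<bar>w x\<bar>))\<^sup>2 - (mass w)\<^sup>2) \<le> form w w"
    using abs_energy_gap by blast
  obtain \<delta> where \<delta>: "0 < \<delta>" and nash_u: "\<And>u. u \<in> X0 \<Longrightarrow> form u u \<le> max \<gamma> (L + 1) * ip u u \<Longrightarrow>
      \<delta> * ip u u \<le> (mass (\<lambda>x. \<bar>u x\<bar>))\<^sup>2"
    using nash_inequality[of "max \<gamma> (L + 1)"] by blast
  have energy_u: "form u u = \<gamma> * U" unfolding U_def by (rule eigen[OF u(1)])
  have au: "(\<lambda>x. \<bar>u x\<bar>) = u" using u(2) by auto
  have "\<delta> * U \<le> B\<^sup>2"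
    unfolding U_def B_def using nash_u[OF u(1)] U energy_u
    by (simp add: au U_def[symmetric] mult_right_mono)
  then have "B\<^sup>2 \<noteq> 0" using mult_pos_pos[OF \<delta> U] by linarith
  then have B: "0 < B"
    unfolding B_def using u(2) by (auto simp: mass_def set_lebesgue_integral_def less_le intro!: integral_nonneg_AE)
  define a where "a = sqrt \<delta>"
  have a: "0 < a" using \<delta> by (simp add: a_def)
  \<comment> \<open>The parameters are chosen backwards. The contradiction at the end will be
    \<open>2 \<kappa> a B \<le> t (1 + g U)\<close>, which determines \<open>t\<close>. The integral of \<open>min p (t u)\<close> will be
    bounded by \<open>\<eta> vol + t D / (4 \<eta>)\<close>. The choice of \<open>\<eta>\<close> makes the first summand at most
    \<open>\<sigma>\<close>, and \<open>D \<le> d\<close> does so for the second; that \<open>D \<le> d\<close> holds is due to the last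
    upper bound on \<open>\<epsilon>\<close>.\<close>
  define t where "t = \<kappa> * a * B / (1 + g * U)"
  have den: "0 < 1 + g * U" using g U by (simp add: add_pos_pos)
  have t: "0 < t" unfolding t_def using \<kappa> a B den by simp
  define vol where "vol = measure lebesgue \<Omega>"
  define \<sigma> where "\<sigma> = min a (t * B) / 4"
  have \<sigma>: "0 < \<sigma>" using a t B by (simp add: \<sigma>_def)
  define \<eta> where "\<eta> = \<sigma> / (vol + 1)"
  have vol: "0 \<le> vol" by (simp add: vol_def)
  have \<eta>: "0 < \<eta>" "\<eta> * vol \<le> \<sigma>" using \<sigma> vol by (simp_all add: \<eta>_def field_simps)
  define d where "d = 4 * \<eta> * \<sigma> / t"
  have d: "0 < d" using \<eta> \<sigma> t by (simp add: d_def)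
  define \<epsilon> where "\<epsilon> = Min {1, t\<^sup>2, d / U * g * d}"
  have \<epsilon>: "0 < \<epsilon>" "\<epsilon> \<le> 1" "\<epsilon> \<le> t\<^sup>2" "\<epsilon> \<le> d / U * g * d"
    using t d U g by (auto simp: \<epsilon>_def)
  obtain v where v: "v \<in> X0" "ip v v = 1" "form v v < L + \<epsilon>"
    using near_minimiser[OF u(1) u(3) \<epsilon>(1)] unfolding L_def .
  define p where "p = (\<lambda>x. \<bar>v x\<bar>)"
  have p: "p \<in> X0" "\<And>x. 0 \<le> p x" using X0_abs[OF v(1)] by (auto simp: p_def)
  have pp: "ip p p = 1" using v(2) by (simp add: p_def ip_def)
  have mv: "\<bar>mass v\<bar> \<le> mass p"
    unfolding p_def by (rule abs_mass_le[OF v(1)])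
  then have "0 \<le> 2 * \<kappa> * ((mass p)\<^sup>2 - (mass v)\<^sup>2)"
    using \<kappa> by (auto intro!: mult_nonneg_nonneg simp: abs_le_square_iff[symmetric])
  then have Ep: "form p p < L + \<epsilon>"
    using gap[OF v(1)] v(3) by (simp add: p_def)
  define A where "A = mass p"
  have "\<delta> * ip p p \<le> (mass (\<lambda>x. \<bar>p x\<bar>))\<^sup>2"
    using Ep \<epsilon>(2) pp by (intro nash_u[OF p(1)]) auto
  then have "\<delta> \<le> A\<^sup>2" using p(2) by (simp add: pp A_def)
  moreover have "0 \<le> A" using mv by (simp add: A_def)
  ultimately have A: "a \<le> A" unfolding a_def by (simp add: real_le_lsqrt)
  define D where "D = ip u p"
  have E: "form (\<lambda>x. 1 * p x + (-\<tau>) * u x) (\<lambda>x. 1 * p x + (-\<tau>) * u x)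
        - L * ip (\<lambda>x. 1 * p x + (-\<tau>) * u x) (\<lambda>x. 1 * p x + (-\<tau>) * u x)
      \<le> \<epsilon> - 2 * \<tau> * g * D + \<tau>\<^sup>2 * g * U" for \<tau>
  proof -
    have "form (\<lambda>x. 1 * p x + (-\<tau>) * u x) (\<lambda>x. 1 * p x + (-\<tau>) * u x)
        - L * ip (\<lambda>x. 1 * p x + (-\<tau>) * u x) (\<lambda>x. 1 * p x + (-\<tau>) * u x)
      = form p p - L - 2 * \<tau> * g * D + \<tau>\<^sup>2 * g * U"
      unfolding lincomb_square[OF p(1) u(1)] form_commute[of p u] ip_commute[of p u] eigen[OF p(1)]
        eigen[OF u(1)] pp
      by (simp add: D_def U_def g_def L_def algebra_simps)
    then show ?thesis using Ep by simp
  qed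
  have D: "D \<le> d"
  proof -
    \<comment> \<open>Here the multiple of \<open>u\<close> is balanced so that \<open>\<epsilon>\<close> and the quadratic term are both at most
      \<open>\<tau> g d\<close>.\<close>
    define \<tau> where "\<tau> = d / U"
    have \<tau>: "0 < \<tau>" using d U by (simp add: \<tau>_def)
    let ?w = "\<lambda>x. 1 * p x + (-\<tau>) * u x"
    have "L * ip ?w ?w \<le> form ?w ?w"
      unfolding L_def by (intro rayleigh X0_lincomb p u)
    then have "2 * \<tau> * g * D \<le> \<epsilon> + \<tau>\<^sup>2 * g * U" using E[of \<tau>] by simp
    also have "\<dots> \<le> \<tau> * g * d + \<tau>\<^sup>2 * g * U" using \<epsilon>(4) by (simp add: \<tau>_def)
    also have "\<tau>\<^sup>2 * g * U = \<tau> * g * d" using U by (simp add: \<tau>_def power2_eq_square)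
    finally have "(2 * \<tau> * g) * D \<le> (2 * \<tau> * g) * d" by (simp add: mult_ac)
    moreover have "0 < 2 * \<tau> * g" using \<tau> g by simp
    ultimately show "D \<le> d" by (simp only: mult_le_cancel_left_pos)
  qed
  let ?w = "\<lambda>x. 1 * p x + (-t) * u x"
  have w: "?w \<in> X0" by (intro X0_lincomb p u)
  have aw: "(\<lambda>x. \<bar>?w x\<bar>) \<in> X0" using w by (rule X0_abs)
  have "form (\<lambda>x. \<bar>?w x\<bar>) (\<lambda>x. \<bar>?w x\<bar>) \<ge> L * ip ?w ?w"
    using rayleigh[OF aw] by (simp add: L_def ip_def)
  then have main: "2 * \<kappa> * ((mass (\<lambda>x. \<bar>?w x\<bar>))\<^sup>2 - (mass ?w)\<^sup>2) \<le> \<epsilon> - 2 * t * g * D + t\<^sup>2 * g * U"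
    using gap[OF w] E[of t] by simp
  have mw: "mass ?w = A - t * B"
    unfolding mass_lincomb[OF p(1) u(1)] A_def B_def by simp
  define \<rho> where "\<rho> = \<eta> * vol + t * D / (4 * \<eta>)"
  have "t * D / (4 * \<eta>) \<le> t * d / (4 * \<eta>)"
    using D t \<eta> by (intro divide_right_mono mult_left_mono) auto
  also have "\<dots> = \<sigma>" using t \<eta> by (simp add: d_def)
  finally have \<rho>: "\<rho> \<le> 2 * \<sigma>" using \<eta> by (simp add: \<rho>_def)
  have D0: "0 \<le> D"
    unfolding D_def ip_def set_lebesgue_integral_def using u(2) p(2) by (intro integral_nonneg_AE) auto
  \<comment> \<open>Since \<open>\<bar>a - b\<bar> = a + b - 2 min a b\<close>, this bounds the integral of \<open>min p (t u)\<close> by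
    \<open>\<rho>\<close>. The minimum \<open>m\<close> is estimated through \<open>m\<^sup>2 \<le> a b\<close> and \<open>4 \<eta> m \<le> 4 \<eta>\<^sup>2 + m\<^sup>2\<close>,
    that is, by a constant plus a multiple of the product, whose integral is \<open>D\<close>.\<close>
  have "A + t * B - 2 * \<rho> \<le> mass (\<lambda>x. \<bar>?w x\<bar>)"
  proof -
    let ?l = "\<lambda>x. (p x + t * u x) - (2 * \<eta> * 1 + t / (2 * \<eta>) * (u x * p x))"
    have "\<Omega> \<in> lmeasurable" using open_domain bounded_domain by (simp add: lmeasurable_open)
    then have one: "set_integrable lebesgue \<Omega> (\<lambda>x. 1::real)" "(LINT x:\<Omega>|lebesgue. 1::real) = vol"
      by (simp_all add: set_integrable_def set_lebesgue_integral_def vol_def fmeasurable_def less_top)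
    note ints = one(1) X0_integrable[OF p(1)] X0_integrable[OF u(1)] ip_integrable[OF u(1) p(1)]
    have i1: "set_integrable lebesgue \<Omega> (\<lambda>x. p x + t * u x)"
      and i2: "set_integrable lebesgue \<Omega> (\<lambda>x. 2 * \<eta> * 1 + t / (2 * \<eta>) * (u x * p x))"
      by (intro set_integral_add set_integrable_mult_right ints)+
    have "(LINT x:\<Omega>|lebesgue. p x + t * u x) = A + t * B"
      unfolding A_def B_def using mass_lincomb[OF p(1) u(1), of 1 t] by (simp add: mass_def)
    moreover have "(LINT x:\<Omega>|lebesgue. 2 * \<eta> * 1 + t / (2 * \<eta>) * (u x * p x)) = 2 * \<eta> * vol + t / (2 * \<eta>) * D"
      by (subst set_integral_add(2))
        (use ints in \<open>simp_all only: set_integrable_mult_right set_integral_mult_right one(2) D_def ip_def\<close>)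
    ultimately have l: "(LINT x:\<Omega>|lebesgue. ?l x) = A + t * B - (2 * \<eta> * vol + t / (2 * \<eta>) * D)"
      unfolding set_integral_diff(2)[OF i1 i2] by simp
    have "set_integrable lebesgue \<Omega> ?l"
      by (rule set_integral_diff(1)[OF i1 i2])
    moreover have "?l x \<le> \<bar>?w x\<bar>" for x
    proof -
      define m where "m = min (p x) (t * u x)"
      have m0: "0 \<le> m" "m \<le> p x" "m \<le> t * u x"
        using p(2)[of x] u(2)[of x] t by (auto simp: m_def)
      have m: "m * m \<le> p x * (t * u x)"
        using m0 p(2)[of x] by (intro mult_mono) auto
      have "0 \<le> (2 * \<eta> - m) * (2 * \<eta> - m)" by simp
      then have "4 * \<eta> * m \<le> 4 * \<eta> * \<eta> + p x * (t * u x)"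
        using m by (simp add: algebra_simps)
      then have "2 * m \<le> 2 * \<eta> + t / (2 * \<eta>) * (u x * p x)"
        using \<eta> by (simp add: field_simps)
      moreover have "\<bar>?w x\<bar> = p x + t * u x - 2 * m" by (simp add: m_def min_def abs_if)
      ultimately show ?thesis by simp
    qed
    ultimately have "(LINT x:\<Omega>|lebesgue. ?l x) \<le> mass (\<lambda>x. \<bar>?w x\<bar>)"
      unfolding mass_def by (intro set_integral_mono X0_integrable[OF aw]) auto
    moreover have "2 * \<rho> = 2 * \<eta> * vol + t / (2 * \<eta>) * D"
      using \<eta>(1) by (simp add: \<rho>_def field_simps)
    ultimately show ?thesis unfolding l by linarith
  qed
  moreover have \<rho>2: "2 * \<rho> \<le> a" "2 * \<rho> \<le> t * B" using \<rho> by (auto simp: \<sigma>_def min_def split: if_splits)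
  ultimately have "(A + t * B - 2 * \<rho>)\<^sup>2 \<le> (mass (\<lambda>x. \<bar>?w x\<bar>))\<^sup>2"
    using A a by (intro power_mono) auto
  moreover have "(A + t * B - 2 * \<rho>)\<^sup>2 - (A - t * B)\<^sup>2 = 4 * ((A - \<rho>) * (t * B - \<rho>))"
    by (simp add: power2_eq_square algebra_simps)
  moreover have "a / 2 * (t * B / 2) \<le> (A - \<rho>) * (t * B - \<rho>)"
  proof (rule mult_mono)
    show "a / 2 \<le> A - \<rho>" "t * B / 2 \<le> t * B - \<rho>" "0 \<le> A - \<rho>"
      using \<rho>2 A a by linarith+
    show "0 \<le> t * B / 2" using t B by simp
  qed
  ultimately have "a * (t * B) \<le> (mass (\<lambda>x. \<bar>?w x\<bar>))\<^sup>2 - (mass ?w)\<^sup>2"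
    unfolding mw by simp
  then have "2 * \<kappa> * (a * (t * B)) \<le> 2 * \<kappa> * ((mass (\<lambda>x. \<bar>?w x\<bar>))\<^sup>2 - (mass ?w)\<^sup>2)"
    using \<kappa> by (intro mult_left_mono) auto
  also have "\<dots> \<le> t\<^sup>2 + t\<^sup>2 * g * U"
  proof -
    have "0 \<le> 2 * t * g * D" using D0 t g by simp
    then show ?thesis using main \<epsilon>(3) by linarith
  qed
  finally have "t * (2 * (\<kappa> * a * B)) \<le> t * (t * (1 + g * U))"
    by (simp add: power2_eq_square algebra_simps)
  then have "2 * (\<kappa> * a * B) \<le> t * (1 + g * U)" using t by simp
  also have "\<dots> = \<kappa> * a * B" using den by (simp add: t_def)
  finally show False using mult_pos_pos[OF mult_pos_pos[OF \<kappa> a] B] by linarith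
qed

section \<open>Fucik eigenvalues beyond the two lines\<close>

lemma fucik_weak_solution_iff:
  "fucik_weak_solution K \<Omega> \<alpha> \<beta> u \<longleftrightarrow>
     u \<in> X0 \<and> (\<forall>v\<in>X0. form u v = \<alpha> * ip (pos_part u) v - \<beta> * ip (neg_part u) v)"
  by (simp add: fucik_weak_solution_def form_def wdiff_mult ip_def)

lemma form_split_parts:
  assumes "u \<in> X0" "v \<in> X0"
  shows "form u v = form (pos_part u) v - form (neg_part u) v"
proof -
  have "(\<lambda>x. 1 * pos_part u x + (-1) * neg_part u x) = u" by (auto simp: max_def)
  then show ?thesis
    using form_lincomb[OF X0_pos_part[OF assms(1)] X0_neg_part[OF assms(1)] assms(2), of 1 "-1"] by simp
qed

lemma ip_pos_neg: "ip (pos_part u) (neg_part u) = 0" "ip (neg_part u) (pos_part u) = 0"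
proof -
  have *: "pos_part u x * neg_part u x = 0" for x by (auto simp: max_def)
  show "ip (pos_part u) (neg_part u) = 0" unfolding ip_def * by simp
  then show "ip (neg_part u) (pos_part u) = 0" by (simp add: ip_commute)
qed

text \<open>
  The energies of \<open>u = u\<^sup>+ - u\<^sup>-\<close> and \<open>\<bar>u\<bar> = u\<^sup>+ + u\<^sup>-\<close> differ by four times the mixed
  term, and their squared masses by four times the product of the masses of the two parts.
\<close>
lemma pos_neg_interaction:
  obtains \<kappa> where "0 < \<kappa>"
    "\<And>u. u \<in> X0 \<Longrightarrow> 2 * \<kappa> * (mass (pos_part u) * mass (neg_part u)) \<le> - form (pos_part u) (neg_part u)"
proof -
  obtain \<kappa> where \<kappa>: "0 < \<kappa>" and gap: "\<And>w. w \<in> X0 \<Longrightarrow>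
      form (\<lambda>x. \<bar>w x\<bar>) (\<lambda>x. \<bar>w x\<bar>) + 2 * \<kappa> * ((mass (\<lambda>x. \<bar>w x\<bar>))\<^sup>2 - (mass w)\<^sup>2) \<le> form w w"
    using abs_energy_gap by blast
  show thesis
  proof (rule that[OF \<kappa>])
    fix u assume u: "u \<in> X0"
    note p = X0_pos_part[OF u] and n = X0_neg_part[OF u]
    have pn: "(\<lambda>x. 1 * pos_part u x + (-1) * neg_part u x) = u"
      "(\<lambda>x. 1 * pos_part u x + 1 * neg_part u x) = (\<lambda>x. \<bar>u x\<bar>)" by (auto simp: max_def)
    show "2 * \<kappa> * (mass (pos_part u) * mass (neg_part u)) \<le> - form (pos_part u) (neg_part u)"
      using gap[OF u] lincomb_square(1)[OF p n, of 1 "-1"] lincomb_square(1)[OF p n, of 1 1]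
        mass_lincomb[OF p n, of 1 "-1"] mass_lincomb[OF p n, of 1 1]
      unfolding pn by (simp add: power2_eq_square algebra_simps)
  qed
qed

lemma mass_nonneg: "(\<And>x. 0 \<le> u x) \<Longrightarrow> 0 \<le> mass u"
  unfolding mass_def set_lebesgue_integral_def by (intro integral_nonneg_AE) auto

text \<open>
  The symmetry that exchanges the two lines, and with them the roles of the two parts of a solution.
\<close>
lemma fucik_reflect:
  assumes "fucik_weak_solution K \<Omega> \<alpha> \<beta> u"
  shows "fucik_weak_solution K \<Omega> \<beta> \<alpha> (\<lambda>x. - u x)"
proof -
  have u: "u \<in> X0" using assms by (simp add: fucik_weak_solution_iff)
  have "form (\<lambda>x. - u x) v = - form u v" if "v \<in> X0" for v
    using form_lincomb[OF u u that, of "-1" 0] by simp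
  then show ?thesis
    using assms X0_scale[OF u, of "-1"] by (simp add: fucik_weak_solution_iff)
qed

text \<open>
  If \<open>\<integral>(u\<^sup>-)\<^sup>2 = 0\<close>, testing with \<open>u\<^sup>-\<close> gives
  \<open>B(u\<^sup>-, u\<^sup>-) = B(u\<^sup>+, u\<^sup>-) \<le> 0\<close>, so the energy of \<open>u\<^sup>-\<close> is zero as well.
  Then \<open>u\<^sup>+\<close> is a nonnegative eigenfunction for the eigenvalue \<open>\<alpha> > \<lambda>\<^sub>1\<close>.
\<close>
lemma neg_part_nontrivial:
  assumes sol: "fucik_weak_solution K \<Omega> \<alpha> \<beta> u" and nz: "\<not> (AE x in lebesgue. u x = 0)"
    and \<alpha>: "lambda1 K \<Omega> < \<alpha>"
  shows "0 < ip (neg_part u) (neg_part u)"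
proof (rule ccontr)
  let ?p = "pos_part u" and ?n = "neg_part u"
  assume "\<not> 0 < ip ?n ?n"
  then have N0: "ip ?n ?n = 0" using ip_nonneg[of ?n] by simp
  have u: "u \<in> X0" and weak: "\<And>v. v \<in> X0 \<Longrightarrow> form u v = \<alpha> * ip ?p v - \<beta> * ip ?n v"
    using sol by (auto simp: fucik_weak_solution_iff)
  note p = X0_pos_part[OF u] and n = X0_neg_part[OF u]
  obtain \<kappa> where \<kappa>: "0 < \<kappa>" "\<And>u. u \<in> X0 \<Longrightarrow>
      2 * \<kappa> * (mass (pos_part u) * mass (neg_part u)) \<le> - form (pos_part u) (neg_part u)"
    using pos_neg_interaction by blast
  have "0 \<le> 2 * \<kappa> * (mass ?p * mass ?n)"
    using \<kappa>(1) by (intro mult_nonneg_nonneg mass_nonneg) auto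
  then have "form ?p ?n \<le> 0" using \<kappa>(2)[OF u] by simp
  moreover have "form ?p ?n = form ?n ?n"
    using weak[OF n] form_split_parts[OF u n] N0 ip_pos_neg[of u] by simp
  ultimately have nn: "form ?n ?n = 0" using form_nonneg[of ?n] by simp
  have "form ?p v = \<alpha> * ip ?p v" if v: "v \<in> X0" for v
    using weak[OF v] form_split_parts[OF u v] form_null[OF n v nn] ip_null[OF n v N0] by simp
  moreover have "0 < ip ?p ?p"
  proof (rule ccontr)
    assume "\<not> 0 < ip ?p ?p"
    then have "ip ?p ?p = 0" using ip_nonneg[of ?p] by simp
    then have "AE x in lebesgue. ?p x = 0" "AE x in lebesgue. ?n x = 0"
      using ip_eq_0D p n N0 by blast+
    then have "AE x in lebesgue. u x = 0"
      by eventually_elim (auto simp: max_def split: if_splits)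
    then show False using nz by simp
  qed
  ultimately have "\<alpha> \<le> lambda1 K \<Omega>"
    using no_nonneg_eigenfunction_above[OF p] by simp
  then show False using \<alpha> by simp
qed

text \<open>
  With \<open>I = 2 \<kappa> \<integral>u\<^sup>+ \<integral>u\<^sup>-\<close>, testing with the two parts of the solution bounds \<open>I\<close> by
  \<open>(\<alpha> - \<lambda>\<^sub>1) \<integral>(u\<^sup>+)\<^sup>2\<close> and by \<open>(\<beta> - \<lambda>\<^sub>1) \<integral>(u\<^sup>-)\<^sup>2\<close>. In the product of
  both bounds the factors \<open>\<integral>(u\<^sup>+)\<^sup>2\<close> and \<open>\<integral>(u\<^sup>-)\<^sup>2\<close> cancel against the Nash
  inequality, whatever the relative size of the two parts.
\<close>
lemma fucik_gap:
  obtains m where "0 < m"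
    "\<And>\<alpha> \<beta>. (\<alpha>, \<beta>) \<in> fucik_spectrum K \<Omega> \<Longrightarrow> lambda1 K \<Omega> < \<alpha> \<Longrightarrow> lambda1 K \<Omega> < \<beta> \<Longrightarrow>
       \<alpha> \<le> M \<Longrightarrow> \<beta> \<le> M \<Longrightarrow> m \<le> (\<alpha> - lambda1 K \<Omega>) * (\<beta> - lambda1 K \<Omega>)"
proof -
  obtain \<kappa> where \<kappa>: "0 < \<kappa>" and inter: "\<And>u. u \<in> X0 \<Longrightarrow>
      2 * \<kappa> * (mass (pos_part u) * mass (neg_part u)) \<le> - form (pos_part u) (neg_part u)"
    using pos_neg_interaction by blast
  obtain \<delta> where \<delta>: "0 < \<delta>" and nash_u: "\<And>u. u \<in> X0 \<Longrightarrow> form u u \<le> M * ip u u \<Longrightarrow>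
      \<delta> * ip u u \<le> (mass (\<lambda>x. \<bar>u x\<bar>))\<^sup>2"
    using nash_inequality[of M] by blast
  show thesis
  proof (rule that[of "4 * \<kappa>\<^sup>2 * \<delta>\<^sup>2"])
    show "0 < 4 * \<kappa>\<^sup>2 * \<delta>\<^sup>2" using \<kappa> \<delta> by simp
    fix \<alpha> \<beta>
    assume "(\<alpha>, \<beta>) \<in> fucik_spectrum K \<Omega>" and \<alpha>: "lambda1 K \<Omega> < \<alpha>" "\<alpha> \<le> M" and \<beta>: "lambda1 K \<Omega> < \<beta>" "\<beta> \<le> M"
    then obtain u where sol: "fucik_weak_solution K \<Omega> \<alpha> \<beta> u" and nz: "\<not> (AE x in lebesgue. u x = 0)"
      by (auto simp: fucik_spectrum_def)
    let ?p = "pos_part u" and ?n = "neg_part u"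
    have u: "u \<in> X0" and weak: "\<And>v. v \<in> X0 \<Longrightarrow> form u v = \<alpha> * ip ?p v - \<beta> * ip ?n v"
      using sol by (auto simp: fucik_weak_solution_iff)
    note p = X0_pos_part[OF u] and n = X0_neg_part[OF u]
    have N: "0 < ip ?n ?n" using neg_part_nontrivial[OF sol nz \<alpha>(1)] .
    have P: "0 < ip ?p ?p" using neg_part_nontrivial[OF fucik_reflect[OF sol] _ \<beta>(1)] nz by simp
    have mp: "0 \<le> mass ?p" and mn: "0 \<le> mass ?n" by (auto intro: mass_nonneg)
    define I where "I = 2 * \<kappa> * (mass ?p * mass ?n)"
    have I: "0 \<le> I" unfolding I_def using \<kappa> mp mn by simp
    have pp: "form ?p ?p - form ?p ?n = \<alpha> * ip ?p ?p"
      using weak[OF p] form_split_parts[OF u p] ip_pos_neg[of u] by (simp add: form_commute)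
    have nn: "form ?n ?n - form ?p ?n = \<beta> * ip ?n ?n"
      using weak[OF n] form_split_parts[OF u n] ip_pos_neg[of u] by simp
    have IP: "I \<le> (\<alpha> - lambda1 K \<Omega>) * ip ?p ?p"
      using pp rayleigh[OF p] inter[OF u] by (simp add: I_def algebra_simps)
    have IN: "I \<le> (\<beta> - lambda1 K \<Omega>) * ip ?n ?n"
      using nn rayleigh[OF n] inter[OF u] by (simp add: I_def algebra_simps)
    have pn: "form ?p ?n \<le> 0"
      using inter[OF u] I unfolding I_def by linarith
    have "form ?p ?p \<le> M * ip ?p ?p"
      using pp pn mult_right_mono[OF \<alpha>(2), of "ip ?p ?p"] P by linarith
    then have dp: "\<delta> * ip ?p ?p \<le> (mass ?p)\<^sup>2"
      using nash_u[OF p] by simp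
    have "form ?n ?n \<le> M * ip ?n ?n"
      using nn pn mult_right_mono[OF \<beta>(2), of "ip ?n ?n"] N by linarith
    then have dn: "\<delta> * ip ?n ?n \<le> (mass ?n)\<^sup>2"
      using nash_u[OF n] by simp
    have "(4 * \<kappa>\<^sup>2 * \<delta>\<^sup>2) * (ip ?p ?p * ip ?n ?n) = 4 * \<kappa>\<^sup>2 * ((\<delta> * ip ?p ?p) * (\<delta> * ip ?n ?n))"
      by (simp add: power2_eq_square)
    also have "\<dots> \<le> 4 * \<kappa>\<^sup>2 * ((mass ?p)\<^sup>2 * (mass ?n)\<^sup>2)"
      using dp dn \<delta> N P by (intro mult_left_mono mult_mono) auto
    also have "\<dots> = I * I" by (simp add: I_def power2_eq_square)
    also have "\<dots> \<le> ((\<alpha> - lambda1 K \<Omega>) * ip ?p ?p) * ((\<beta> - lambda1 K \<Omega>) * ip ?n ?n)"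
      using IP IN I \<alpha> P by (intro mult_mono) auto
    also have "\<dots> = ((\<alpha> - lambda1 K \<Omega>) * (\<beta> - lambda1 K \<Omega>)) * (ip ?p ?p * ip ?n ?n)"
      by simp
    finally show "4 * \<kappa>\<^sup>2 * \<delta>\<^sup>2 \<le> (\<alpha> - lambda1 K \<Omega>) * (\<beta> - lambda1 K \<Omega>)"
      using mult_pos_pos[OF P N] by (simp only: mult_le_cancel_right_pos)
  qed
qed

end

theorem proposition3p1:
  fixes s :: real and \<Omega> :: "'a::euclidean_space set" and K :: "'a \<Rightarrow> real"
  assumes "0 < s" and "s < 1" and "real DIM('a) > 2 * s"
    and "bounded_lipschitz_domain \<Omega>"
    and "fractional_kernel s K"
  shows "\<not> (\<exists>(\<alpha>s :: nat \<Rightarrow> real) (\<beta>s :: nat \<Rightarrow> real) (\<alpha> :: real) (\<beta> :: real).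
           (\<forall>k. (\<alpha>s k, \<beta>s k) \<in> fucik_spectrum K \<Omega> \<and>
                \<alpha>s k > lambda1 K \<Omega> \<and> \<beta>s k > lambda1 K \<Omega>) \<and>
           (\<lambda>k. (\<alpha>s k, \<beta>s k)) \<longlonglongrightarrow> (\<alpha>, \<beta>) \<and>
           (\<alpha> = lambda1 K \<Omega> \<or> \<beta> = lambda1 K \<Omega>))"
proof (intro notI, elim exE conjE)
  fix \<alpha>s \<beta>s :: "nat \<Rightarrow> real" and \<alpha> \<beta> :: real
  assume mem: "\<forall>k. (\<alpha>s k, \<beta>s k) \<in> fucik_spectrum K \<Omega> \<and> \<alpha>s k > lambda1 K \<Omega> \<and> \<beta>s k > lambda1 K \<Omega>"
    and lim: "(\<lambda>k. (\<alpha>s k, \<beta>s k)) \<longlonglongrightarrow> (\<alpha>, \<beta>)"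
    and edge: "\<alpha> = lambda1 K \<Omega> \<or> \<beta> = lambda1 K \<Omega>"
  obtain c where c: "0 < c" "\<And>x. x \<noteq> 0 \<Longrightarrow> c * norm x powr (- (real DIM('a) + 2 * s)) \<le> K x"
    using assms(5) unfolding fractional_kernel_def by blast
  interpret nonlocal_dirichlet \<Omega> K s c
    using assms(1,4) c by unfold_locales (auto simp: bounded_lipschitz_domain_def)
  have lim\<alpha>: "\<alpha>s \<longlonglongrightarrow> \<alpha>" and lim\<beta>: "\<beta>s \<longlonglongrightarrow> \<beta>"
    using tendsto_fst[OF lim] tendsto_snd[OF lim] by simp_all
  obtain M1 M2 where "\<And>k. norm (\<alpha>s k) \<le> M1" "\<And>k. norm (\<beta>s k) \<le> M2"
    using convergent_imp_Bseq[OF convergentI[OF lim\<alpha>]] convergent_imp_Bseq[OF convergentI[OF lim\<beta>]]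
    unfolding Bseq_def by blast
  then have M: "\<alpha>s k \<le> max M1 M2" "\<beta>s k \<le> max M1 M2" for k
    by (smt (verit) real_norm_def)+
  obtain m where m: "0 < m"
    "\<And>\<alpha> \<beta>. (\<alpha>, \<beta>) \<in> fucik_spectrum K \<Omega> \<Longrightarrow> lambda1 K \<Omega> < \<alpha> \<Longrightarrow> lambda1 K \<Omega> < \<beta> \<Longrightarrow>
       \<alpha> \<le> max M1 M2 \<Longrightarrow> \<beta> \<le> max M1 M2 \<Longrightarrow> m \<le> (\<alpha> - lambda1 K \<Omega>) * (\<beta> - lambda1 K \<Omega>)"
    using fucik_gap[of "max M1 M2"] by blast
  have "(\<lambda>k. (\<alpha>s k - lambda1 K \<Omega>) * (\<beta>s k - lambda1 K \<Omega>))
      \<longlonglongrightarrow> (\<alpha> - lambda1 K \<Omega>) * (\<beta> - lambda1 K \<Omega>)"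
    by (intro tendsto_intros lim\<alpha> lim\<beta>)
  moreover have "m \<le> (\<alpha>s k - lambda1 K \<Omega>) * (\<beta>s k - lambda1 K \<Omega>)" for k
    using m(2) mem M by blast
  ultimately have "m \<le> (\<alpha> - lambda1 K \<Omega>) * (\<beta> - lambda1 K \<Omega>)"
    by (intro LIMSEQ_le_const) auto
  then show False using edge m(1) by auto
qed

end
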